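(* There exist absolute constants $C,c>0$ such that for every prime power $q$ and every $n\ge1$ the following holds. Let $A_n$ be chosen uniformly from $\operatorname{GL}_n(\mathbf{F}_q)$ and let $M_n=A_n-I$, where $I$ is the identity matrix. Then $$\|Q(M_n)-Q_\infty\|_{TV}\le\Big(\frac{C}{q}\Big)^{cn}.$$
   Context: For an $n\times n$ matrix $M$, $Q(M)=n-\operatorname{rank}(M)$. $Q_\infty$ is the random variable on $\{0,1,2,\dots\}$ with $$\mathbf{P}(Q_\infty=k)=\frac{1}{q^{k^2}}\frac{\prod_{i=k+1}^\infty(1-1/q^i)}{\prod_{i=1}^k(1-1/q^i)}.$$ $\|\cdot-\cdot\|_{TV}$ is the total variation distance between distributions. *)

theory Defs
  imports
    "HOL-Probability.Probability"
    "HOL-Number_Theory.Prime_Powers"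
    "Jordan_Normal_Form.Missing_VectorSpace"
begin

text \<open>
  The constants in the theorem must be chosen before the finite field, so the field has to be a
  bound variable of a formula and cannot be a type class instance. Fields are therefore records of
  HOL-Algebra, and matrices and their rank are defined over such a record. An \<open>n \<times> n\<close> matrix is an
  extensional function on pairs of indices below \<open>n\<close>.
\<close>

definition mat_ring :: "('a, 'b) ring_scheme \<Rightarrow> nat \<Rightarrow> (nat \<times> nat \<Rightarrow> 'a) ring" where
  "mat_ring R n =
    \<lparr>carrier = {..<n} \<times> {..<n} \<rightarrow>\<^sub>E carrier R,
     mult = (\<lambda>A B. \<lambda>(i, j)\<in>{..<n} \<times> {..<n}. \<Oplus>\<^bsub>R\<^esub>k\<in>{..<n}. A (i, k) \<otimes>\<^bsub>R\<^esub> B (k, j)),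
     one = (\<lambda>(i, j)\<in>{..<n} \<times> {..<n}. if i = j then \<one>\<^bsub>R\<^esub> else \<zero>\<^bsub>R\<^esub>),
     zero = (\<lambda>(i, j)\<in>{..<n} \<times> {..<n}. \<zero>\<^bsub>R\<^esub>),
     add = (\<lambda>A B. \<lambda>(i, j)\<in>{..<n} \<times> {..<n}. A (i, j) \<oplus>\<^bsub>R\<^esub> B (i, j))\<rparr>"

abbreviation GL :: "nat \<Rightarrow> ('a, 'b) ring_scheme \<Rightarrow> (nat \<times> nat \<Rightarrow> 'a) set" where
  "GL n F \<equiv> Units (mat_ring F n)"

definition mat_cols :: "nat \<Rightarrow> (nat \<times> nat \<Rightarrow> 'a) \<Rightarrow> (nat \<Rightarrow> 'a) set" where
  "mat_cols n A = (\<lambda>j. \<lambda>i\<in>{..<n}. A (i, j)) ` {..<n}"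

text \<open>The rank is the dimension of the column space, a subspace of the space \<open>F\<^sup>n\<close> of functions
  on \<open>{..<n}\<close>.\<close>

definition mat_rank :: "('a, 'b) ring_scheme \<Rightarrow> nat \<Rightarrow> (nat \<times> nat \<Rightarrow> 'a) \<Rightarrow> nat" where
  "mat_rank F n A =
    (let V = ring.func_space F {..<n}
     in vectorspace.dim F (V\<lparr>carrier := module.span F V (mat_cols n A)\<rparr>))"

definition corank :: "('a, 'b) ring_scheme \<Rightarrow> nat \<Rightarrow> (nat \<times> nat \<Rightarrow> 'a) \<Rightarrow> nat" where
  "corank F n A = n - mat_rank F n A"

definition Q_inf_mass :: "nat \<Rightarrow> nat \<Rightarrow> real" where
  "Q_inf_mass q k =
    1 / real q ^ (k ^ 2) *
    ((\<Prod>i. 1 - 1 / real q ^ (k + 1 + i)) / (\<Prod>i=1..k. 1 - 1 / real q ^ i))"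

text \<open>The distribution of \<open>Q\<^sub>\<infinity>\<close>, as the measure on the natural numbers with the given point
  masses.\<close>

definition Q_inf :: "nat \<Rightarrow> nat measure" where
  "Q_inf q = density (count_space UNIV) (\<lambda>k. ennreal (Q_inf_mass q k))"

definition tv_dist :: "'a measure \<Rightarrow> 'a measure \<Rightarrow> real" where
  "tv_dist M N = (SUP A\<in>sets M. \<bar>measure M A - measure N A\<bar>)"

lemma ring_mat_ring:
  fixes R (structure)
  assumes "ring R"
  shows "ring (mat_ring R n)"
proof -
  interpret ring R by fact
  let ?I = "{..<n} \<times> {..<n}"
  let ?M = "mat_ring R n"
  have ent: "A (i, j) \<in> carrier R" if "A \<in> carrier ?M" "i < n" "j < n" for A i j
    using that by (auto simp: mat_ring_def PiE_iff)
  have eqI: "A = B" if "A \<in> carrier ?M" "B \<in> carrier ?M"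
      "\<And>i j. i < n \<Longrightarrow> j < n \<Longrightarrow> A (i, j) = B (i, j)" for A B
    using that by (intro PiE_ext[of A ?I "\<lambda>_. carrier R" B]) (auto simp: mat_ring_def)
  have mc: "A \<otimes>\<^bsub>?M\<^esub> B \<in> carrier ?M" if "A \<in> carrier ?M" "B \<in> carrier ?M" for A B
    using ent[OF that(1)] ent[OF that(2)]
    by (auto simp: mat_ring_def intro!: finsum_closed)
  have ac: "A \<oplus>\<^bsub>?M\<^esub> B \<in> carrier ?M" if "A \<in> carrier ?M" "B \<in> carrier ?M" for A B
    using ent[OF that(1)] ent[OF that(2)] by (auto simp: mat_ring_def)
  have oc: "\<one>\<^bsub>?M\<^esub> \<in> carrier ?M" and zc: "\<zero>\<^bsub>?M\<^esub> \<in> carrier ?M"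
    by (auto simp: mat_ring_def)
  have m: "(A \<otimes>\<^bsub>?M\<^esub> B) (i, j) = (\<Oplus>k\<in>{..<n}. A (i, k) \<otimes> B (k, j))"
    and a: "(A \<oplus>\<^bsub>?M\<^esub> B) (i, j) = A (i, j) \<oplus> B (i, j)"
    and o: "\<one>\<^bsub>?M\<^esub> (i, j) = (if i = j then \<one> else \<zero>)"
    and z: "\<zero>\<^bsub>?M\<^esub> (i, j) = \<zero>" if "i < n" "j < n" for A B i j
    using that by (auto simp: mat_ring_def)
  show ?thesis
  proof (intro ringI abelian_groupI monoidI)
    fix A assume A: "A \<in> carrier ?M"
    let ?B = "\<lambda>(i, j)\<in>?I. \<ominus> A (i, j)"
    have "?B \<in> carrier ?M" using ent[OF A] by (auto simp: mat_ring_def)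
    moreover from this have "?B \<oplus>\<^bsub>?M\<^esub> A = \<zero>\<^bsub>?M\<^esub>"
      using A ent[OF A] by (intro eqI) (auto simp: a z ac zc l_neg)
    ultimately show "\<exists>B\<in>carrier ?M. B \<oplus>\<^bsub>?M\<^esub> A = \<zero>\<^bsub>?M\<^esub>" by blast
    show "\<one>\<^bsub>?M\<^esub> \<otimes>\<^bsub>?M\<^esub> A = A"
    proof (rule eqI)
      fix i j assume ij: "i < n" "j < n"
      have "(\<Oplus>k\<in>{..<n}. \<one>\<^bsub>?M\<^esub> (i, k) \<otimes> A (k, j)) = (\<Oplus>k\<in>{..<n}. if i = k then A (k, j) else \<zero>)"
        using ij ent[OF A] by (intro finsum_cong') (auto simp: o)
      also have "\<dots> = A (i, j)" using ij ent[OF A] by (intro add.finprod_singleton) auto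
      finally show "(\<one>\<^bsub>?M\<^esub> \<otimes>\<^bsub>?M\<^esub> A) (i, j) = A (i, j)" using ij by (simp add: m)
    qed (use A oc mc in auto)
    show "A \<otimes>\<^bsub>?M\<^esub> \<one>\<^bsub>?M\<^esub> = A"
    proof (rule eqI)
      fix i j assume ij: "i < n" "j < n"
      have "(\<Oplus>k\<in>{..<n}. A (i, k) \<otimes> \<one>\<^bsub>?M\<^esub> (k, j)) = (\<Oplus>k\<in>{..<n}. if j = k then A (i, k) else \<zero>)"
        using ij ent[OF A] by (intro finsum_cong') (auto simp: o)
      also have "\<dots> = A (i, j)" using ij ent[OF A] by (intro add.finprod_singleton) auto
      finally show "(A \<otimes>\<^bsub>?M\<^esub> \<one>\<^bsub>?M\<^esub>) (i, j) = A (i, j)" using ij by (simp add: m)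
    qed (use A oc mc in auto)
    show "\<zero>\<^bsub>?M\<^esub> \<oplus>\<^bsub>?M\<^esub> A = A"
      using A ent[OF A] by (intro eqI) (auto simp: a z ac zc)
  next
    fix A B C assume A: "A \<in> carrier ?M" and B: "B \<in> carrier ?M" and C: "C \<in> carrier ?M"
    note e = ent[OF A] ent[OF B] ent[OF C]
    show "(A \<oplus>\<^bsub>?M\<^esub> B) \<oplus>\<^bsub>?M\<^esub> C = A \<oplus>\<^bsub>?M\<^esub> (B \<oplus>\<^bsub>?M\<^esub> C)"
      using A B C e by (intro eqI) (auto simp: a ac a_assoc)
    show "(A \<oplus>\<^bsub>?M\<^esub> B) \<otimes>\<^bsub>?M\<^esub> C = A \<otimes>\<^bsub>?M\<^esub> C \<oplus>\<^bsub>?M\<^esub> B \<otimes>\<^bsub>?M\<^esub> C"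
    proof (rule eqI)
      fix i j assume ij: "i < n" "j < n"
      have "(\<Oplus>k\<in>{..<n}. (A \<oplus>\<^bsub>?M\<^esub> B) (i, k) \<otimes> C (k, j)) =
          (\<Oplus>k\<in>{..<n}. A (i, k) \<otimes> C (k, j) \<oplus> B (i, k) \<otimes> C (k, j))"
        using ij e by (intro finsum_cong') (auto simp: a l_distr)
      also have "\<dots> = (\<Oplus>k\<in>{..<n}. A (i, k) \<otimes> C (k, j)) \<oplus> (\<Oplus>k\<in>{..<n}. B (i, k) \<otimes> C (k, j))"
        using ij e by (intro finsum_addf) auto
      finally show "((A \<oplus>\<^bsub>?M\<^esub> B) \<otimes>\<^bsub>?M\<^esub> C) (i, j) = (A \<otimes>\<^bsub>?M\<^esub> C \<oplus>\<^bsub>?M\<^esub> B \<otimes>\<^bsub>?M\<^esub> C) (i, j)"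
        using ij by (simp add: m a)
    qed (use A B C ac mc in auto)
    show "C \<otimes>\<^bsub>?M\<^esub> (A \<oplus>\<^bsub>?M\<^esub> B) = C \<otimes>\<^bsub>?M\<^esub> A \<oplus>\<^bsub>?M\<^esub> C \<otimes>\<^bsub>?M\<^esub> B"
    proof (rule eqI)
      fix i j assume ij: "i < n" "j < n"
      have "(\<Oplus>k\<in>{..<n}. C (i, k) \<otimes> (A \<oplus>\<^bsub>?M\<^esub> B) (k, j)) =
          (\<Oplus>k\<in>{..<n}. C (i, k) \<otimes> A (k, j) \<oplus> C (i, k) \<otimes> B (k, j))"
        using ij e by (intro finsum_cong') (auto simp: a r_distr)
      also have "\<dots> = (\<Oplus>k\<in>{..<n}. C (i, k) \<otimes> A (k, j)) \<oplus> (\<Oplus>k\<in>{..<n}. C (i, k) \<otimes> B (k, j))"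
        using ij e by (intro finsum_addf) auto
      finally show "(C \<otimes>\<^bsub>?M\<^esub> (A \<oplus>\<^bsub>?M\<^esub> B)) (i, j) = (C \<otimes>\<^bsub>?M\<^esub> A \<oplus>\<^bsub>?M\<^esub> C \<otimes>\<^bsub>?M\<^esub> B) (i, j)"
        using ij by (simp add: m a)
    qed (use A B C ac mc in auto)
    have swap: "(\<Oplus>k\<in>S. \<Oplus>l\<in>T. f k l) = (\<Oplus>l\<in>T. \<Oplus>k\<in>S. f k l)"
      if "finite S" "finite T" "\<And>k l. k \<in> S \<Longrightarrow> l \<in> T \<Longrightarrow> f k l \<in> carrier R"
      for S T :: "nat set" and f
      using that
    proof (induction S rule: finite_induct)
      case empty
      show ?case by (simp add: finsum_zero)
    next
      case (insert x S)
      have "(\<Oplus>l\<in>T. \<Oplus>k\<in>insert x S. f k l) = (\<Oplus>l\<in>T. f x l \<oplus> (\<Oplus>k\<in>S. f k l))"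
        using insert.prems insert.hyps
        by (intro finsum_cong') (auto intro!: a_closed finsum_closed finsum_insert)
      also have "\<dots> = (\<Oplus>l\<in>T. f x l) \<oplus> (\<Oplus>l\<in>T. \<Oplus>k\<in>S. f k l)"
        using insert.prems by (intro finsum_addf) (auto intro!: finsum_closed)
      also have "\<dots> = (\<Oplus>l\<in>T. f x l) \<oplus> (\<Oplus>k\<in>S. \<Oplus>l\<in>T. f k l)"
        using insert by auto
      also have "\<dots> = (\<Oplus>k\<in>insert x S. \<Oplus>l\<in>T. f k l)"
        using insert.prems insert.hyps
        by (intro finsum_insert[symmetric]) (auto intro!: finsum_closed)
      finally show ?case ..
    qed
    show "(A \<otimes>\<^bsub>?M\<^esub> B) \<otimes>\<^bsub>?M\<^esub> C = A \<otimes>\<^bsub>?M\<^esub> (B \<otimes>\<^bsub>?M\<^esub> C)"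
    proof (rule eqI)
      fix i j assume ij: "i < n" "j < n"
      have "(\<Oplus>k\<in>{..<n}. (A \<otimes>\<^bsub>?M\<^esub> B) (i, k) \<otimes> C (k, j)) =
          (\<Oplus>k\<in>{..<n}. \<Oplus>l\<in>{..<n}. A (i, l) \<otimes> B (l, k) \<otimes> C (k, j))"
        using ij e
        by (intro finsum_cong') (auto simp: m intro!: finsum_closed finsum_ldistr)
      also have "\<dots> = (\<Oplus>l\<in>{..<n}. \<Oplus>k\<in>{..<n}. A (i, l) \<otimes> B (l, k) \<otimes> C (k, j))"
        using ij e by (intro swap) auto
      also have "\<dots> = (\<Oplus>l\<in>{..<n}. \<Oplus>k\<in>{..<n}. A (i, l) \<otimes> (B (l, k) \<otimes> C (k, j)))"
        using ij e by (intro finsum_cong' finsum_closed) (auto simp: m_assoc intro!: finsum_closed)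
      also have "\<dots> = (\<Oplus>l\<in>{..<n}. A (i, l) \<otimes> (B \<otimes>\<^bsub>?M\<^esub> C) (l, j))"
        using ij e
        by (intro finsum_cong')
          (auto simp: m intro!: finsum_closed finsum_rdistr[symmetric])
      finally show "((A \<otimes>\<^bsub>?M\<^esub> B) \<otimes>\<^bsub>?M\<^esub> C) (i, j) = (A \<otimes>\<^bsub>?M\<^esub> (B \<otimes>\<^bsub>?M\<^esub> C)) (i, j)"
        using ij by (simp add: m)
    qed (use A B C mc in auto)
  next
    fix A B assume A: "A \<in> carrier ?M" and B: "B \<in> carrier ?M"
    show "A \<oplus>\<^bsub>?M\<^esub> B = B \<oplus>\<^bsub>?M\<^esub> A"
      using A B ent[OF A] ent[OF B] by (intro eqI) (auto simp: a ac a_comm)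
  qed (use ac mc oc zc in auto)
qed

lemma finite_GL: "finite (carrier F) \<Longrightarrow> finite (GL n F)"
  by (rule finite_subset[of _ "carrier (mat_ring F n)"])
    (auto simp: Units_def mat_ring_def intro!: finite_PiE)

lemma GL_nonempty: "ring F \<Longrightarrow> GL n F \<noteq> {}"
  using monoid.Units_one_closed[OF ring.is_monoid[OF ring_mat_ring]] by blast

end

theory Submission
  imports Defs "HOL-Algebra.Group_Action"
begin

text \<open>
  The idea is to compare the two distributions through their moments. Write \<open>Q\<close> for the corank of
  \<open>A - I\<close>, that is, the dimension of the space of vectors fixed by \<open>A\<close>. The group \<open>GL\<^sub>n(F)\<close> acts
  on the linearly independent lists of \<open>j \<le> n\<close> vectors of \<open>F\<^sup>n\<close>, and it does so transitively, so by
  Burnside's lemma a random \<open>A\<close> fixes exactly one such list on average. A list is fixed iff it lies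
  in the fixed space, which has \<open>q\<^sup>Q\<close> elements, so this reads
  \<open>E[(q\<^sup>Q - 1)(q\<^sup>Q - q) \<dots> (q\<^sup>Q - q\<^sup>j\<^sup>-\<^sup>1)] = 1\<close> for all \<open>j \<le> n\<close>
  (\<open>sum_GL_corank_moment\<close>).

  These products are the \<open>q\<close>-analogue of falling factorials, and inclusion--exclusion recovers the
  point masses from them: an alternating sum of \<open>n + 1 - k\<close> moments is the indicator of \<open>Q = k\<close>
  (\<open>indicator_eq_frame_sum\<close>). Hence \<open>P(Q = k)\<close> equals
  \<open>(\<Sum>i\<le>n-k. (-1)\<^sup>i q\<^sup>-\<^sup>k\<^sup>i / ((q - 1) \<dots> (q\<^sup>i - 1))) / |GL\<^sub>k(F)|\<close>
  (\<open>card_GL_corank_eq\<close>).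

  By Euler's identity the same series without truncation has the value
  \<open>(1 - q\<^sup>-\<^sup>k\<^sup>-\<^sup>1) (1 - q\<^sup>-\<^sup>k\<^sup>-\<^sup>2) \<dots>\<close> (\<open>euler_product\<close>). Divided by \<open>|GL\<^sub>k(F)|\<close> this is the point mass
  of \<open>Q\<^sub>\<infinity>\<close> at \<open>k\<close>. So the point masses differ by the tail of an alternating series with decreasing
  terms, which is at most its first term. Even a rough estimate bounds that term, divided by
  \<open>|GL\<^sub>k(F)|\<close>, by
  \<open>2 \<cdot> 2\<^sup>-\<^sup>k q\<^sup>-\<^sup>n\<close> (\<open>truncation_error_bound\<close>). Summation over \<open>k\<close> gives the distance \<open>4 q\<^sup>-\<^sup>n\<close>,
  and the theorem holds with \<open>C = 4\<close> and \<open>c = 1\<close>.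
\<close>

section \<open>Independent lists in a finite vector space\<close>

context vectorspace
begin

lemma card_span_lin_indpt:
  assumes "finite S" "S \<subseteq> carrier V" "lin_indpt S"
  shows "card (span S) = card (carrier K) ^ card S"
proof -
  let ?f = "\<lambda>a. lincomb a S"
  have "bij_betw ?f (S \<rightarrow>\<^sub>E carrier K) (span S)"
  proof (rule bij_betw_imageI)
    show "inj_on ?f (S \<rightarrow>\<^sub>E carrier K)"
    proof (rule inj_onI)
      fix a b assume a: "a \<in> S \<rightarrow>\<^sub>E carrier K" and b: "b \<in> S \<rightarrow>\<^sub>E carrier K"
        and eq: "lincomb a S = lincomb b S"
      have fn: "a \<in> S \<rightarrow> carrier K" "b \<in> S \<rightarrow> carrier K" using a b by auto
      have "lincomb (\<lambda>v. a v \<ominus>\<^bsub>K\<^esub> b v) S = \<zero>\<^bsub>V\<^esub>"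
        using assms fn eq by (simp add: lincomb_diff M.r_neg M.minus_eq)
      moreover have "(\<lambda>v. a v \<ominus>\<^bsub>K\<^esub> b v) \<in> S \<rightarrow> carrier K" using fn by auto
      ultimately have "a v \<ominus>\<^bsub>K\<^esub> b v = \<zero>\<^bsub>K\<^esub>" if "v \<in> S" for v
        using assms that lin_dep_crit[of S S "\<lambda>v. a v \<ominus>\<^bsub>K\<^esub> b v" v] by auto
      then have "a v = b v" if "v \<in> S" for v
        using fn that by (simp add: R.minus_other_side Pi_iff)
      then show "a = b" using a b by (auto intro: PiE_ext)
    qed
    show "?f ` (S \<rightarrow>\<^sub>E carrier K) = span S"
    proof -
      have "lincomb a S \<in> ?f ` (S \<rightarrow>\<^sub>E carrier K)" if "a \<in> S \<rightarrow> carrier K" for a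
      proof -
        have "lincomb a S = lincomb (restrict a S) S"
          using assms that by (intro lincomb_cong) auto
        moreover have "restrict a S \<in> S \<rightarrow>\<^sub>E carrier K" using that by simp
        ultimately show ?thesis by (metis (no_types, lifting) imageI)
      qed
      then show ?thesis using assms by (auto simp: finite_span)
    qed
  qed
  then have "card (span S) = card (S \<rightarrow>\<^sub>E carrier K)" by (simp add: bij_betw_same_card)
  then show ?thesis using assms by (simp add: card_PiE)
qed

lemma finite_carrier_imp_fin_dim:
  assumes "finite (carrier V)"
  shows "fin_dim"
  unfolding fin_dim_def
  using assms in_own_span[of "carrier V"] span_is_subset2[of "carrier V"]
  by (intro exI[of _ "carrier V"]) (simp add: subset_antisym)

lemma card_carrier_eq_dim:
  assumes "finite (carrier V)"
  shows "card (carrier V) = card (carrier K) ^ dim"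
proof -
  obtain B where "finite B" "basis B"
    using finite_basis_exists[OF finite_carrier_imp_fin_dim[OF assms]] by blast
  then show ?thesis
    using card_span_lin_indpt[of B] dim_basis[of B] by (auto simp: basis_def)
qed

text \<open>
  Lists rather than sets: a matrix fixes a list iff it fixes every vector in it, and the number of
  lists is a plain product.
\<close>

definition indep_lists :: "'c set \<Rightarrow> nat \<Rightarrow> 'c list set" where
  "indep_lists W j = {xs. length xs = j \<and> set xs \<subseteq> W \<and> distinct xs \<and> lin_indpt (set xs)}"

lemma indep_lists_0: "indep_lists W 0 = {[]}"
  by (auto simp: indep_lists_def lin_dep_def)

lemma indep_lists_Suc:
  assumes "W \<subseteq> carrier V"
  shows "indep_lists W (Suc j) =
    (\<lambda>(xs, v). v # xs) ` (SIGMA xs:indep_lists W j. W - span (set xs))"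
proof -
  have "v # xs \<in> indep_lists W (Suc j) \<longleftrightarrow> xs \<in> indep_lists W j \<and> v \<in> W - span (set xs)" for v xs
  proof (cases "xs \<in> indep_lists W j \<and> v \<in> W")
    case True
    then have s: "set xs \<subseteq> carrier V" "lin_indpt (set xs)" "v \<in> carrier V"
      using assms by (auto simp: indep_lists_def)
    have "v \<in> span (set xs)" if "v \<in> set xs" using in_own_span[OF s(1)] that by blast
    then have "v \<notin> span (set xs) \<longleftrightarrow> v \<notin> set xs \<and> lin_indpt (insert v (set xs))"
      using lin_dep_iff_in_span[OF s] by auto
    then show ?thesis using True by (auto simp: indep_lists_def)
  next
    case False
    then show ?thesis
      using supset_ld_is_ld[of "set xs" "insert v (set xs)"] by (auto simp: indep_lists_def)
  qed
  moreover have "\<exists>v ys. xs = v # ys" if "xs \<in> indep_lists W (Suc j)" for xs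
    using that by (cases xs) (auto simp: indep_lists_def)
  ultimately show ?thesis by (force simp: image_iff)
qed

lemma finite_indep_lists: "finite W \<Longrightarrow> finite (indep_lists W j)"
  using finite_lists_length_eq[of W j] by (rule rev_finite_subset) (auto simp: indep_lists_def)

lemma card_span_indep_list:
  assumes "W \<subseteq> carrier V" "xs \<in> indep_lists W j"
  shows "card (span (set xs)) = card (carrier K) ^ j"
  using assms card_span_lin_indpt[of "set xs"] by (auto simp: indep_lists_def distinct_card)

text \<open>
  The vectors are chosen one after the other. After \<open>i\<close> choices the span has \<open>q\<^sup>i\<close> elements, all of
  them in \<open>W\<close>, and the next vector may be any element of \<open>W\<close> outside it. As \<open>|W|\<close> is itself a power
  of \<open>q\<close>, the factor \<open>0\<close> occurs as soon as \<open>j\<close> exceeds the dimension of \<open>W\<close>, so the negative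
  factors after it do no harm.
\<close>

lemma card_indep_lists:
  assumes "submodule K W V" "finite W"
  shows "real (card (indep_lists W j)) = (\<Prod>i<j. real (card W) - real (card (carrier K)) ^ i)"
proof (induction j)
  case 0
  then show ?case by (simp add: indep_lists_0)
next
  case (Suc j)
  have W: "W \<subseteq> carrier V" using assms(1) by (rule submodule.subset)
  have ext: "real (card (W - span (set xs))) = real (card W) - real (card (carrier K)) ^ j"
    if "xs \<in> indep_lists W j" for xs
  proof -
    have "span (set xs) \<subseteq> W"
      using that assms(1) by (intro span_is_subset) (auto simp: indep_lists_def)
    then show ?thesis
      using card_span_indep_list[OF W that] assms(2)
        card_mono[of W "span (set xs)"]
      by (simp add: card_Diff_subset finite_subset of_nat_diff flip: of_nat_power)
  qed
  have "card (indep_lists W (Suc j)) = card (SIGMA xs:indep_lists W j. W - span (set xs))"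
    unfolding indep_lists_Suc[OF W] by (rule card_image) (auto simp: inj_on_def)
  also have "\<dots> = (\<Sum>xs\<in>indep_lists W j. card (W - span (set xs)))"
    using assms finite_indep_lists by (intro card_SigmaI) auto
  finally have "real (card (indep_lists W (Suc j))) =
      (\<Sum>xs\<in>indep_lists W j. real (card W) - real (card (carrier K)) ^ j)"
    by (simp add: ext)
  then show ?case using Suc.IH by simp
qed

text \<open>
  Over a finite field this needs only counting: the span of fewer than \<open>dim\<close> vectors has too few
  elements to be the whole space.
\<close>

lemma indep_list_extend:
  assumes "finite (carrier V)" "xs \<in> indep_lists (carrier V) j" "j \<le> dim"
    and "finite (carrier K)"
  shows "\<exists>us. us @ xs \<in> indep_lists (carrier V) dim"
  using assms(2,3)
proof (induction "dim - j" arbitrary: j xs)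
  case 0
  then show ?case by (auto intro: exI[of _ "[]"])
next
  case (Suc d)
  have "card (carrier K) > 1"
    using card_mono[of "carrier K" "{\<zero>\<^bsub>K\<^esub>, \<one>\<^bsub>K\<^esub>}"] assms(4) by simp
  then have "card (span (set xs)) < card (carrier V)"
    using card_span_indep_list[OF _ Suc.prems(1)] card_carrier_eq_dim[OF assms(1)] Suc.hyps(2)
    by (simp add: power_strict_increasing)
  moreover have "span (set xs) \<subseteq> carrier V"
    using Suc.prems(1) by (intro span_is_subset2) (auto simp: indep_lists_def)
  ultimately obtain v where "v \<in> carrier V - span (set xs)"
    by (metis Diff_eq_empty_iff all_not_in_conv less_irrefl subset_antisym)
  then have "v # xs \<in> indep_lists (carrier V) (Suc j)"
    using Suc.prems(1) by (auto simp: indep_lists_Suc)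
  with Suc.hyps obtain us where "us @ v # xs \<in> indep_lists (carrier V) dim"
    using Suc.hyps(1)[of "Suc j" "v # xs"] by fastforce
  then show ?case by (intro exI[of _ "us @ [v]"]) simp
qed

lemma span_indep_list_dim:
  assumes "finite (carrier V)" "xs \<in> indep_lists (carrier V) dim"
  shows "span (set xs) = carrier V"
proof (rule card_subset_eq)
  show "span (set xs) \<subseteq> carrier V"
    using assms(2) by (intro span_is_subset2) (auto simp: indep_lists_def)
qed (use assms card_span_indep_list[OF subset_refl assms(2)] card_carrier_eq_dim in simp_all)

end

section \<open>Matrices over a finite field as linear maps\<close>

definition mat_vec :: "('a, 'b) ring_scheme \<Rightarrow> nat \<Rightarrow> (nat \<times> nat \<Rightarrow> 'a) \<Rightarrow> (nat \<Rightarrow> 'a) \<Rightarrow> nat \<Rightarrow> 'a" where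
  "mat_vec R n A x = (\<lambda>i\<in>{..<n}. \<Oplus>\<^bsub>R\<^esub>k\<in>{..<n}. A (i, k) \<otimes>\<^bsub>R\<^esub> x k)"

definition mat_col :: "nat \<Rightarrow> (nat \<times> nat \<Rightarrow> 'a) \<Rightarrow> nat \<Rightarrow> nat \<Rightarrow> 'a" where
  "mat_col n A j = (\<lambda>i\<in>{..<n}. A (i, j))"

definition mat_of_cols :: "nat \<Rightarrow> (nat \<Rightarrow> nat \<Rightarrow> 'a) \<Rightarrow> nat \<times> nat \<Rightarrow> 'a" where
  "mat_of_cols n c = (\<lambda>(i, j)\<in>{..<n} \<times> {..<n}. c j i)"

locale finite_matrices = field F for F (structure) +
  fixes n :: nat
  assumes finite_F: "finite (carrier F)" and n_pos: "n \<ge> 1"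
begin

abbreviation "V \<equiv> func_space {..<n}"
abbreviation "M \<equiv> mat_ring F n"
abbreviation "q \<equiv> card (carrier F)"

sublocale M: ring M by (rule ring_mat_ring) (rule is_ring)

sublocale V: vectorspace F V
  using func_space_is_module[of "{..<n}"] field_axioms by (simp add: vectorspace_def)

lemma V_simps:
  "carrier V = {..<n} \<rightarrow>\<^sub>E carrier F"
  "\<zero>\<^bsub>V\<^esub> = (\<lambda>i\<in>{..<n}. \<zero>)"
  "v \<oplus>\<^bsub>V\<^esub> w = (\<lambda>i\<in>{..<n}. v i \<oplus> w i)"
  "c \<odot>\<^bsub>V\<^esub> v = (\<lambda>i\<in>{..<n}. c \<otimes> v i)"
  by (simp_all add: func_space_def)

lemma finite_V: "finite (carrier V)"
  by (simp add: V_simps finite_PiE finite_F)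

lemma card_field_gt_1: "q > 1"
  using card_mono[of "carrier F" "{\<zero>, \<one>}"] finite_F by simp

lemma dim_V: "V.dim = n"
proof -
  have "q ^ V.dim = card (carrier V)" using V.card_carrier_eq_dim[OF finite_V] by simp
  also have "\<dots> = q ^ n" by (simp add: V_simps card_PiE)
  finally show ?thesis using card_field_gt_1 by simp
qed

lemma mat_entry_closed: "A \<in> carrier M \<Longrightarrow> i < n \<Longrightarrow> j < n \<Longrightarrow> A (i, j) \<in> carrier F"
  by (auto simp: mat_ring_def PiE_iff)

lemma mat_col_closed: "A \<in> carrier M \<Longrightarrow> j < n \<Longrightarrow> mat_col n A j \<in> carrier V"
  by (auto simp: V_simps mat_col_def mat_entry_closed)

lemma mat_of_cols_closed: "(\<And>j. j < n \<Longrightarrow> c j \<in> carrier V) \<Longrightarrow> mat_of_cols n c \<in> carrier M"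
  by (auto simp: V_simps mat_of_cols_def mat_ring_def PiE_iff)

lemma mat_col_of_cols: "(\<And>j. j < n \<Longrightarrow> c j \<in> carrier V) \<Longrightarrow> j < n \<Longrightarrow> mat_col n (mat_of_cols n c) j = c j"
  by (fastforce simp: V_simps mat_col_def mat_of_cols_def PiE_iff extensional_def)

lemma mat_eqI_cols:
  assumes "A \<in> carrier M" "B \<in> carrier M" "\<And>j. j < n \<Longrightarrow> mat_col n A j = mat_col n B j"
  shows "A = B"
proof (rule PiE_ext)
  show "A \<in> {..<n} \<times> {..<n} \<rightarrow>\<^sub>E carrier F" "B \<in> {..<n} \<times> {..<n} \<rightarrow>\<^sub>E carrier F"
    using assms by (auto simp: mat_ring_def)
  fix x assume "x \<in> {..<n} \<times> {..<n}"
  then obtain i j where "x = (i, j)" "i < n" "j < n" by auto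
  then show "A x = B x" using fun_cong[OF assms(3), of j i] by (simp add: mat_col_def)
qed

lemma mat_vec_closed: "A \<in> carrier M \<Longrightarrow> x \<in> carrier V \<Longrightarrow> mat_vec F n A x \<in> carrier V"
  by (auto simp: V_simps mat_vec_def mat_entry_closed PiE_iff intro!: finsum_closed)

lemma mat_col_mult:
  assumes "A \<in> carrier M" "B \<in> carrier M" "j < n"
  shows "mat_col n (A \<otimes>\<^bsub>M\<^esub> B) j = mat_vec F n A (mat_col n B j)"
proof
  fix i
  have "(\<Oplus>k\<in>{..<n}. A (i, k) \<otimes> B (k, j)) = (\<Oplus>k\<in>{..<n}. A (i, k) \<otimes> mat_col n B j k)" if "i < n"
    using assms that by (intro finsum_cong') (auto simp: mat_col_def mat_entry_closed)
  then show "mat_col n (A \<otimes>\<^bsub>M\<^esub> B) j i = mat_vec F n A (mat_col n B j) i"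
    using assms by (simp add: mat_ring_def mat_col_def mat_vec_def)
qed

lemma mat_col_add: "j < n \<Longrightarrow> mat_col n (A \<oplus>\<^bsub>M\<^esub> B) j = mat_col n A j \<oplus>\<^bsub>V\<^esub> mat_col n B j"
  by (auto simp: mat_ring_def mat_col_def V_simps)

text \<open>
  Every vector is a column of some square matrix, and \<open>mat_col_mult\<close> says that multiplication acts
  on each column separately. The laws for matrices acting on vectors are therefore the ring axioms
  of the matrix ring read off in column \<open>0\<close>, which exists because \<open>n \<ge> 1\<close>.
\<close>

lemma obtain_mat_with_col:
  assumes "x \<in> carrier V"
  obtains X where "X \<in> carrier M" "mat_col n X 0 = x"
proof
  show "mat_of_cols n (\<lambda>_. x) \<in> carrier M" using assms by (intro mat_of_cols_closed)
  show "mat_col n (mat_of_cols n (\<lambda>_. x)) 0 = x" using assms n_pos by (intro mat_col_of_cols) auto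
qed

lemma mat_vec_mult:
  assumes "A \<in> carrier M" "B \<in> carrier M" "x \<in> carrier V"
  shows "mat_vec F n (A \<otimes>\<^bsub>M\<^esub> B) x = mat_vec F n A (mat_vec F n B x)"
proof -
  obtain X where "X \<in> carrier M" "mat_col n X 0 = x" using obtain_mat_with_col[OF assms(3)] .
  then show ?thesis
    using assms n_pos mat_col_mult[of "A \<otimes>\<^bsub>M\<^esub> B" X 0] mat_col_mult[of A "B \<otimes>\<^bsub>M\<^esub> X" 0]
      mat_col_mult[of B X 0] by (simp add: M.m_assoc)
qed

lemma mat_vec_one:
  assumes "x \<in> carrier V"
  shows "mat_vec F n \<one>\<^bsub>M\<^esub> x = x"
proof -
  obtain X where "X \<in> carrier M" "mat_col n X 0 = x" using obtain_mat_with_col[OF assms] .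
  then show ?thesis using n_pos mat_col_mult[of "\<one>\<^bsub>M\<^esub>" X 0] by simp
qed

lemma mat_vec_add_left:
  assumes "A \<in> carrier M" "B \<in> carrier M" "x \<in> carrier V"
  shows "mat_vec F n (A \<oplus>\<^bsub>M\<^esub> B) x = mat_vec F n A x \<oplus>\<^bsub>V\<^esub> mat_vec F n B x"
proof -
  obtain X where "X \<in> carrier M" "mat_col n X 0 = x" using obtain_mat_with_col[OF assms(3)] .
  then show ?thesis
    using assms n_pos mat_col_mult[of "A \<oplus>\<^bsub>M\<^esub> B" X 0] mat_col_mult[of A X 0] mat_col_mult[of B X 0]
    by (simp add: M.l_distr mat_col_add)
qed

lemma mat_vec_add_right:
  assumes "A \<in> carrier M" "x \<in> carrier V" "y \<in> carrier V"
  shows "mat_vec F n A (x \<oplus>\<^bsub>V\<^esub> y) = mat_vec F n A x \<oplus>\<^bsub>V\<^esub> mat_vec F n A y"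
proof -
  obtain X where "X \<in> carrier M" "mat_col n X 0 = x" using obtain_mat_with_col[OF assms(2)] .
  moreover obtain Y where "Y \<in> carrier M" "mat_col n Y 0 = y" using obtain_mat_with_col[OF assms(3)] .
  ultimately show ?thesis
    using assms n_pos mat_col_mult[of A "X \<oplus>\<^bsub>M\<^esub> Y" 0] mat_col_mult[of A X 0] mat_col_mult[of A Y 0]
    by (simp add: M.r_distr mat_col_add)
qed

lemma mat_vec_smult:
  assumes "A \<in> carrier M" "x \<in> carrier V" "c \<in> carrier F"
  shows "mat_vec F n A (c \<odot>\<^bsub>V\<^esub> x) = c \<odot>\<^bsub>V\<^esub> mat_vec F n A x"
proof
  fix i
  have "(\<Oplus>k\<in>{..<n}. A (i, k) \<otimes> (\<lambda>i\<in>{..<n}. c \<otimes> x i) k) = c \<otimes> (\<Oplus>k\<in>{..<n}. A (i, k) \<otimes> x k)" if "i < n"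
  proof -
    have "(\<Oplus>k\<in>{..<n}. A (i, k) \<otimes> (\<lambda>i\<in>{..<n}. c \<otimes> x i) k) = (\<Oplus>k\<in>{..<n}. c \<otimes> (A (i, k) \<otimes> x k))"
      using assms that
      by (intro finsum_cong') (auto simp: mat_entry_closed V_simps PiE_iff m_lcomm)
    also have "\<dots> = c \<otimes> (\<Oplus>k\<in>{..<n}. A (i, k) \<otimes> x k)"
      using assms that
      by (intro finsum_rdistr[symmetric]) (auto simp: mat_entry_closed V_simps PiE_iff)
    finally show ?thesis .
  qed
  then show "mat_vec F n A (c \<odot>\<^bsub>V\<^esub> x) i = (c \<odot>\<^bsub>V\<^esub> mat_vec F n A x) i"
    by (auto simp: mat_vec_def V_simps)
qed

lemma linear_mat_vec:
  assumes "A \<in> carrier M"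
  shows "linear_map F V V (mat_vec F n A)"
  using assms mat_vec_closed mat_vec_add_right mat_vec_smult
  by (intro linear_map.intro V.vectorspace_axioms mod_hom.intro V.module_axioms mod_hom_axioms.intro)
    (simp add: module_hom_def)

lemma mat_cols_eq: "mat_cols n A = mat_col n A ` {..<n}"
  by (simp add: mat_cols_def mat_col_def)

lemma mat_col_eq_mat_vec:
  assumes "A \<in> carrier M" "j < n"
  shows "mat_col n A j = mat_vec F n A (mat_col n \<one>\<^bsub>M\<^esub> j)"
  using assms mat_col_mult[of A "\<one>\<^bsub>M\<^esub>" j] by simp

text \<open>
  The product \<open>A x\<close> is the combination of the columns of \<open>A\<close> with coefficients \<open>x\<close>, which gives one
  inclusion. For the other one, column \<open>j\<close> of \<open>A\<close> is the image of column \<open>j\<close> of the identity matrix.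
\<close>

lemma mat_vec_image:
  assumes A: "A \<in> carrier M"
  shows "mat_vec F n A ` carrier V = V.span (mat_cols n A)"
proof
  interpret L: linear_map F V V "mat_vec F n A" by (rule linear_mat_vec[OF A])
  have cols: "mat_cols n A \<subseteq> carrier V" using A by (auto simp: mat_cols_eq mat_col_closed)
  have sub: "submodule F (V.span (mat_cols n A)) V" by (rule V.span_is_submodule[OF cols])
  show "mat_vec F n A ` carrier V \<subseteq> V.span (mat_cols n A)"
  proof (rule image_subsetI)
    fix x assume x: "x \<in> carrier V"
    \<comment> \<open>Arbitrary partial sums instead of the whole combination, to allow induction.\<close>
    have "(\<lambda>i\<in>{..<n}. \<Oplus>k\<in>S. A (i, k) \<otimes> x k) \<in> V.span (mat_cols n A)" if "finite S" "S \<subseteq> {..<n}" for S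
      using that
    proof (induction S)
      case empty
      have "(\<lambda>i\<in>{..<n}. \<Oplus>k\<in>{}. A (i, k) \<otimes> x k) = \<zero>\<^bsub>V\<^esub>"
        by (simp only: V_simps finsum_empty)
      then show ?case using submodule.zero_closed[OF sub] by (simp only:)
    next
      case (insert j S)
      have "(\<lambda>i\<in>{..<n}. \<Oplus>k\<in>insert j S. A (i, k) \<otimes> x k) =
          x j \<odot>\<^bsub>V\<^esub> mat_col n A j \<oplus>\<^bsub>V\<^esub> (\<lambda>i\<in>{..<n}. \<Oplus>k\<in>S. A (i, k) \<otimes> x k)"
      proof
        fix i
        have "(\<Oplus>k\<in>insert j S. A (i, k) \<otimes> x k) = x j \<otimes> A (i, j) \<oplus> (\<Oplus>k\<in>S. A (i, k) \<otimes> x k)" if "i < n"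
        proof -
          have "A (i, k) \<in> carrier F" "x k \<in> carrier F" if "k \<in> insert j S" for k
            using that \<open>i < n\<close> insert.prems A x by (auto simp: mat_entry_closed V_simps)
          then have "(\<Oplus>k\<in>insert j S. A (i, k) \<otimes> x k) = A (i, j) \<otimes> x j \<oplus> (\<Oplus>k\<in>S. A (i, k) \<otimes> x k)"
              and "A (i, j) \<otimes> x j = x j \<otimes> A (i, j)"
            using insert.hyps by (auto simp: Pi_iff intro!: finsum_insert m_comm)
          then show ?thesis by simp
        qed
        then show "(\<lambda>i\<in>{..<n}. \<Oplus>k\<in>insert j S. A (i, k) \<otimes> x k) i =
            (x j \<odot>\<^bsub>V\<^esub> mat_col n A j \<oplus>\<^bsub>V\<^esub> (\<lambda>i\<in>{..<n}. \<Oplus>k\<in>S. A (i, k) \<otimes> x k)) i"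
          by (simp add: V_simps mat_col_def)
      qed
      moreover have "x j \<in> carrier F" "mat_col n A j \<in> V.span (mat_cols n A)"
        using insert.prems x V.in_own_span[OF cols] by (auto simp: V_simps mat_cols_eq)
      moreover have "(\<lambda>i\<in>{..<n}. \<Oplus>k\<in>S. A (i, k) \<otimes> x k) \<in> V.span (mat_cols n A)"
        using insert.IH insert.prems by blast
      ultimately show ?case
        using submodule.m_closed[OF sub submodule.smult_closed[OF sub]] by presburger
    qed
    from this[of "{..<n}"] show "mat_vec F n A x \<in> V.span (mat_cols n A)" by (simp add: mat_vec_def)
  qed
  have "mat_cols n A \<subseteq> L.im"
    unfolding mat_cols_eq L.im_def
    using mat_col_eq_mat_vec[OF A] mat_col_closed[OF M.one_closed] by blast
  then show "V.span (mat_cols n A) \<subseteq> mat_vec F n A ` carrier V"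
    using V.span_is_subset[OF _ L.im_is_submodule] by (simp add: L.im_def)
qed

text \<open>
  Rank--nullity turns the corank, which is defined through the column space, into the dimension of
  the kernel; what the moments need is the number of elements of that kernel.
\<close>

lemma card_ker_mat_vec:
  assumes A: "A \<in> carrier M"
  shows "card {x \<in> carrier V. mat_vec F n A x = \<zero>\<^bsub>V\<^esub>} = q ^ corank F n A" "corank F n A \<le> n"
    and "submodule F {x \<in> carrier V. mat_vec F n A x = \<zero>\<^bsub>V\<^esub>} V"
proof -
  interpret L: linear_map F V V "mat_vec F n A" by (rule linear_mat_vec[OF A])
  interpret K: vectorspace F "V.vs L.ker" by (rule V.subspace_is_vs[OF L.kerT_is_subspace])
  have fin: "finite L.ker" unfolding L.ker_def using finite_V by simp
  have "mat_rank F n A = vectorspace.dim F (V.vs L.im)"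
    unfolding mat_rank_def Let_def L.im_def mat_vec_image[OF A] ..
  then have rn: "mat_rank F n A + K.dim = n"
    using L.rank_nullity[OF V.finite_carrier_imp_fin_dim[OF finite_V]] dim_V by simp
  then have "corank F n A = K.dim" by (simp add: corank_def)
  then show "card {x \<in> carrier V. mat_vec F n A x = \<zero>\<^bsub>V\<^esub>} = q ^ corank F n A"
    using K.card_carrier_eq_dim fin by (simp add: L.ker_def)
  show "corank F n A \<le> n" by (simp add: corank_def)
  show "submodule F {x \<in> carrier V. mat_vec F n A x = \<zero>\<^bsub>V\<^esub>} V"
    using L.ker_is_submodule by (simp add: L.ker_def)
qed

lemma mat_vec_minus_one_eq_zero_iff:
  assumes "A \<in> carrier M" "x \<in> carrier V"
  shows "mat_vec F n (A \<ominus>\<^bsub>M\<^esub> \<one>\<^bsub>M\<^esub>) x = \<zero>\<^bsub>V\<^esub> \<longleftrightarrow> mat_vec F n A x = x"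
proof -
  have "A = (A \<ominus>\<^bsub>M\<^esub> \<one>\<^bsub>M\<^esub>) \<oplus>\<^bsub>M\<^esub> \<one>\<^bsub>M\<^esub>"
    using assms by (simp add: M.minus_eq M.a_assoc M.l_neg)
  then have "mat_vec F n A x = mat_vec F n (A \<ominus>\<^bsub>M\<^esub> \<one>\<^bsub>M\<^esub>) x \<oplus>\<^bsub>V\<^esub> x"
    using assms mat_vec_add_left[of "A \<ominus>\<^bsub>M\<^esub> \<one>\<^bsub>M\<^esub>" "\<one>\<^bsub>M\<^esub>" x] by (simp add: mat_vec_one)
  then show ?thesis
    using assms mat_vec_closed[of "A \<ominus>\<^bsub>M\<^esub> \<one>\<^bsub>M\<^esub>" x] V.M.add.r_cancel_one' by auto
qed

text \<open>
  If the columns span, then \<open>A\<close> is surjective on \<open>F\<^sup>n\<close>, hence injective, as \<open>F\<^sup>n\<close> is finite.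
  Preimages of the unit vectors are the columns of a right inverse \<open>B\<close>. Injectivity makes \<open>B\<close> a left
  inverse too, because \<open>A (B A) = A\<close>.
\<close>

lemma GL_if_cols_span:
  assumes A: "A \<in> carrier M" and "V.span (mat_cols n A) = carrier V"
  shows "A \<in> GL n F"
proof -
  have surj: "mat_vec F n A ` carrier V = carrier V" using mat_vec_image[OF A] assms(2) by simp
  then have inj: "inj_on (mat_vec F n A) (carrier V)" by (simp add: finite_V finite_surj_inj eq_card_imp_inj_on)
  have "\<exists>y. y \<in> carrier V \<and> mat_vec F n A y = mat_col n \<one>\<^bsub>M\<^esub> j" if "j < n" for j
    using surj mat_col_closed[of "\<one>\<^bsub>M\<^esub>" j] that by (metis M.one_closed imageE)
  then obtain b where b: "\<And>j. j < n \<Longrightarrow> b j \<in> carrier V"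
      "\<And>j. j < n \<Longrightarrow> mat_vec F n A (b j) = mat_col n \<one>\<^bsub>M\<^esub> j" by metis
  let ?B = "mat_of_cols n b"
  have B: "?B \<in> carrier M" using b by (intro mat_of_cols_closed)
  have AB: "A \<otimes>\<^bsub>M\<^esub> ?B = \<one>\<^bsub>M\<^esub>"
    using A B b by (intro mat_eqI_cols) (auto simp: mat_col_mult mat_col_of_cols)
  have "?B \<otimes>\<^bsub>M\<^esub> A = \<one>\<^bsub>M\<^esub>"
  proof (rule mat_eqI_cols)
    fix j assume j: "j < n"
    have "mat_vec F n A (mat_col n (?B \<otimes>\<^bsub>M\<^esub> A) j) = mat_col n (A \<otimes>\<^bsub>M\<^esub> (?B \<otimes>\<^bsub>M\<^esub> A)) j"
      using A B j by (simp add: mat_col_mult)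
    also have "\<dots> = mat_vec F n A (mat_col n \<one>\<^bsub>M\<^esub> j)"
      using A B j AB mat_col_eq_mat_vec[OF A j] by (simp flip: M.m_assoc)
    finally show "mat_col n (?B \<otimes>\<^bsub>M\<^esub> A) j = mat_col n \<one>\<^bsub>M\<^esub> j"
      using inj A B j by (auto dest!: inj_onD intro!: mat_col_closed)
  qed (use A B in auto)
  with A B AB show ?thesis by (auto simp: Units_def)
qed

section \<open>Moments of the corank of a random invertible matrix\<close>

text \<open>
  The last \<open>j\<close> columns, not the first, because independent lists are extended at the front.
\<close>

definition frame :: "nat \<Rightarrow> (nat \<times> nat \<Rightarrow> 'a) \<Rightarrow> (nat \<Rightarrow> 'a) list" where
  "frame j B = drop (n - j) (map (mat_col n B) [0..<n])"

lemma map_mat_vec_frame: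
  "A \<in> carrier M \<Longrightarrow> B \<in> carrier M \<Longrightarrow> map (mat_vec F n A) (frame j B) = frame j (A \<otimes>\<^bsub>M\<^esub> B)"
  by (auto simp: frame_def drop_map mat_col_mult dest: in_set_dropD)

text \<open>
  An invertible matrix is surjective, so its \<open>n\<close> columns generate a space of dimension \<open>n\<close> and must
  be distinct and independent.
\<close>

lemma GL_cols_indep:
  assumes "B \<in> GL n F"
  shows "map (mat_col n B) [0..<n] \<in> V.indep_lists (carrier V) n"
proof -
  have B: "B \<in> carrier M" using assms by auto
  have cols: "mat_cols n B \<subseteq> carrier V" "finite (mat_cols n B)" "card (mat_cols n B) \<le> n"
    using B card_image_le[of "{..<n}" "mat_col n B"] by (auto simp: mat_cols_eq mat_col_closed)
  have "carrier V \<subseteq> mat_vec F n B ` carrier V"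
  proof
    fix x assume x: "x \<in> carrier V"
    then have "x = mat_vec F n B (mat_vec F n (inv\<^bsub>M\<^esub> B) x)"
      using assms B by (simp add: mat_vec_one flip: mat_vec_mult)
    then show "x \<in> mat_vec F n B ` carrier V"
      using x assms by (metis imageI mat_vec_closed M.Units_inv_closed)
  qed
  then have span: "V.span (mat_cols n B) = carrier V"
    using mat_vec_image[OF B] V.span_is_subset2[OF cols(1)] by simp
  then have "V.basis (mat_cols n B)"
    using cols dim_V by (intro V.dim_gen_is_basis) auto
  then have "V.lin_indpt (mat_cols n B)" "card (mat_cols n B) = n"
    using V.dim_basis[OF cols(2)] dim_V by (auto simp: V.basis_def)
  moreover have "set (map (mat_col n B) [0..<n]) = mat_cols n B"
    by (auto simp: mat_cols_eq)
  ultimately show ?thesis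
    using cols by (auto simp: V.indep_lists_def intro!: card_distinct)
qed

text \<open>
  Independent lists are exactly the ends of the column lists of invertible matrices: complete the
  list to a basis and use it as the columns. With this description \<open>A\<close> acts on lists as left
  multiplication by \<open>A\<close> acts on \<open>GL\<close>, and the properties of the action follow from group laws.
\<close>

lemma indep_lists_eq_frames:
  assumes "j \<le> n"
  shows "V.indep_lists (carrier V) j = frame j ` GL n F"
proof (intro equalityI subsetI)
  fix xs assume "xs \<in> frame j ` GL n F"
  then obtain B where B: "B \<in> GL n F" "xs = frame j B" by auto
  have "set (drop (n - j) ys) \<subseteq> set ys" for ys :: "(nat \<Rightarrow> 'a) list" by (rule set_drop_subset)
  then show "xs \<in> V.indep_lists (carrier V) j"
    using GL_cols_indep[OF B(1)] assms B(2) V.supset_ld_is_ld[of "set xs" "set (map (mat_col n B) [0..<n])"]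
    unfolding V.indep_lists_def frame_def by (fastforce simp del: set_map set_upt)
next
  fix xs assume xs: "xs \<in> V.indep_lists (carrier V) j"
  then obtain us where us: "us @ xs \<in> V.indep_lists (carrier V) n"
    using V.indep_list_extend[OF finite_V xs] assms dim_V finite_F by auto
  let ?B = "mat_of_cols n ((!) (us @ xs))"
  have c: "(us @ xs) ! l \<in> carrier V" if "l < n" for l
    using us that nth_mem[of l "us @ xs"] unfolding V.indep_lists_def by blast
  have cols: "map (mat_col n ?B) [0..<n] = us @ xs"
    using us c by (intro nth_equalityI) (auto simp: mat_col_of_cols V.indep_lists_def)
  have "mat_cols n ?B = set (us @ xs)"
    using arg_cong[OF cols, of set] by (simp add: mat_cols_eq atLeast0LessThan)
  then have "?B \<in> GL n F"
    using c V.span_indep_list_dim[OF finite_V, unfolded dim_V, OF us]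
    by (intro GL_if_cols_span mat_of_cols_closed) simp_all
  moreover have "frame j ?B = xs"
    using us xs unfolding frame_def cols by (auto simp: V.indep_lists_def)
  ultimately show "xs \<in> frame j ` GL n F" by (metis imageI)
qed

definition frame_action :: "nat \<Rightarrow> (nat \<times> nat \<Rightarrow> 'a) \<Rightarrow> (nat \<Rightarrow> 'a) list \<Rightarrow> (nat \<Rightarrow> 'a) list" where
  "frame_action j A = (\<lambda>xs\<in>V.indep_lists (carrier V) j. map (mat_vec F n A) xs)"

lemma frame_action_frame:
  assumes "A \<in> GL n F" "B \<in> GL n F" "j \<le> n"
  shows "frame_action j A (frame j B) = frame j (A \<otimes>\<^bsub>M\<^esub> B)"
  using assms by (simp add: frame_action_def indep_lists_eq_frames map_mat_vec_frame M.Units_closed)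

lemma group_action_frames:
  assumes j: "j \<le> n"
  shows "group_action (units_of M) (V.indep_lists (carrier V) j) (frame_action j)"
proof -
  let ?E = "V.indep_lists (carrier V) j"
  note E = indep_lists_eq_frames[OF j]
  have Bij: "frame_action j A \<in> Bij ?E" if A: "A \<in> GL n F" for A
  proof -
    have "bij_betw (frame_action j A) ?E ?E"
    proof (rule bij_betw_byWitness[where f' = "frame_action j (inv\<^bsub>M\<^esub> A)"])
      show "\<forall>xs\<in>?E. frame_action j (inv\<^bsub>M\<^esub> A) (frame_action j A xs) = xs"
        "\<forall>xs\<in>?E. frame_action j A (frame_action j (inv\<^bsub>M\<^esub> A) xs) = xs"
        "frame_action j A ` ?E \<subseteq> ?E" "frame_action j (inv\<^bsub>M\<^esub> A) ` ?E \<subseteq> ?E"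
        using A j unfolding E
        by (auto simp: frame_action_frame M.Units_closed M.m_assoc[symmetric])
    qed
    then show ?thesis by (simp add: Bij_def frame_action_def)
  qed
  have "frame_action j (A \<otimes>\<^bsub>M\<^esub> B) = compose ?E (frame_action j A) (frame_action j B)"
    if "A \<in> GL n F" "B \<in> GL n F" for A B
  proof (rule extensionalityI[of _ ?E])
    fix xs assume "xs \<in> ?E"
    then obtain C where "C \<in> GL n F" "xs = frame j C" unfolding E by auto
    then show "frame_action j (A \<otimes>\<^bsub>M\<^esub> B) xs = compose ?E (frame_action j A) (frame_action j B) xs"
      using that j \<open>xs \<in> ?E\<close> by (simp add: compose_def frame_action_frame M.m_assoc M.Units_closed)
  qed (auto simp: frame_action_def)
  with Bij have "frame_action j \<in> hom (units_of M) (BijGroup ?E)"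
    by (auto simp: hom_def BijGroup_def units_of_def)
  then show ?thesis
    by (simp add: group_action_def group_hom_def group_hom_axioms_def M.units_group group_BijGroup)
qed

text \<open>
  The frame of \<open>B\<close> is moved to the frame of \<open>C\<close> by \<open>C B\<^sup>-\<^sup>1\<close>. So there is a single orbit, and Burnside's
  lemma says that a group element fixes one list on average.
\<close>

lemma sum_card_fixed_frames:
  assumes j: "j \<le> n"
  shows "(\<Sum>A\<in>GL n F. card {xs \<in> V.indep_lists (carrier V) j. map (mat_vec F n A) xs = xs}) =
    card (GL n F)"
proof -
  let ?E = "V.indep_lists (carrier V) j"
  interpret group_action "units_of M" ?E "frame_action j" by (rule group_action_frames[OF j])
  have orb: "orbit (units_of M) (frame_action j) xs = ?E" if xs: "xs \<in> ?E" for xs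
  proof -
    obtain B where B: "B \<in> GL n F" "xs = frame j B"
      using xs unfolding indep_lists_eq_frames[OF j] by blast
    have "frame j C \<in> (\<lambda>A. frame_action j A xs) ` GL n F" if C: "C \<in> GL n F" for C
    proof (rule image_eqI)
      show "frame j C = frame_action j (C \<otimes>\<^bsub>M\<^esub> inv\<^bsub>M\<^esub> B) xs"
        using B C j by (simp add: frame_action_frame M.m_assoc M.Units_closed)
      show "C \<otimes>\<^bsub>M\<^esub> inv\<^bsub>M\<^esub> B \<in> GL n F" using B C by simp
    qed
    moreover have "frame_action j A xs \<in> ?E" if "A \<in> GL n F" for A
      using that B j by (auto simp: frame_action_frame indep_lists_eq_frames)
    ultimately show ?thesis
      unfolding orbit_def units_of_carrier by (auto simp: indep_lists_eq_frames[OF j])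
  qed
  have "?E \<noteq> {}"
    using indep_lists_eq_frames[OF j] M.Units_one_closed by blast
  then have "orbits (units_of M) ?E (frame_action j) = {?E}"
    unfolding orbits_def using orb by auto
  moreover have "invariants ?E (frame_action j) A = {xs \<in> ?E. map (mat_vec F n A) xs = xs}" for A
    by (auto simp: invariants_def frame_action_def)
  ultimately show ?thesis
    using burnside finite_GL[OF finite_F] V.finite_indep_lists[OF finite_V]
    by (simp add: units_of_carrier order_def)
qed

lemma fixed_frames_eq:
  assumes "A \<in> carrier M"
  shows "{xs \<in> V.indep_lists (carrier V) j. map (mat_vec F n A) xs = xs} =
    V.indep_lists {x \<in> carrier V. mat_vec F n (A \<ominus>\<^bsub>M\<^esub> \<one>\<^bsub>M\<^esub>) x = \<zero>\<^bsub>V\<^esub>} j"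
proof -
  have "map (mat_vec F n A) xs = xs \<longleftrightarrow> (\<forall>x\<in>set xs. mat_vec F n A x = x)" for xs
    using map_eq_conv[of "mat_vec F n A" xs "\<lambda>x. x"] by simp
  then show ?thesis
    using mat_vec_minus_one_eq_zero_iff[OF assms] by (auto simp: V.indep_lists_def subset_eq)
qed

text \<open>
  A list is fixed by \<open>A\<close> iff all its entries lie in the kernel of \<open>A - I\<close>, so the number of fixed
  lists depends only on the corank of \<open>A - I\<close>.
\<close>

lemma sum_GL_corank_moment:
  assumes "j \<le> n"
  shows "(\<Sum>A\<in>GL n F. \<Prod>i<j. real q ^ corank F n (A \<ominus>\<^bsub>M\<^esub> \<one>\<^bsub>M\<^esub>) - real q ^ i) = real (card (GL n F))"
proof -
  have "real (card {xs \<in> V.indep_lists (carrier V) j. map (mat_vec F n A) xs = xs}) =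
      (\<Prod>i<j. real q ^ corank F n (A \<ominus>\<^bsub>M\<^esub> \<one>\<^bsub>M\<^esub>) - real q ^ i)" if "A \<in> GL n F" for A
  proof -
    have "A \<in> carrier M" "A \<ominus>\<^bsub>M\<^esub> \<one>\<^bsub>M\<^esub> \<in> carrier M" using that by auto
    then show ?thesis
      using V.card_indep_lists[OF card_ker_mat_vec(3)] finite_V
      by (simp add: fixed_frames_eq card_ker_mat_vec(1))
  qed
  then have "(\<Sum>A\<in>GL n F. \<Prod>i<j. real q ^ corank F n (A \<ominus>\<^bsub>M\<^esub> \<one>\<^bsub>M\<^esub>) - real q ^ i) =
      (\<Sum>A\<in>GL n F. real (card {xs \<in> V.indep_lists (carrier V) j. map (mat_vec F n A) xs = xs}))"
    by simp
  then show ?thesis using sum_card_fixed_frames[OF assms] by (simp flip: of_nat_sum)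
qed

end

section \<open>Inversion of the moments\<close>

text \<open>
  The \<open>q\<close>-factorial of \<open>i\<close> times \<open>(q - 1)\<^sup>i\<close>.
\<close>

definition qfact :: "real \<Rightarrow> nat \<Rightarrow> real" where
  "qfact q i = (\<Prod>l=1..i. q ^ l - 1)"

lemma qfact_0 [simp]: "qfact q 0 = 1"
  by (simp add: qfact_def)

lemma qfact_Suc [simp]: "qfact q (Suc i) = qfact q i * (q ^ Suc i - 1)"
  by (simp add: qfact_def)

text \<open>
  For a prime power \<open>q\<close> this is the number of independent lists of length \<open>j\<close> in a space of dimension
  \<open>x\<close> over the field with \<open>q\<close> elements; for \<open>j = x\<close> it is the order of \<open>GL\<^sub>x\<close>.
\<close>

definition frame_count :: "real \<Rightarrow> nat \<Rightarrow> nat \<Rightarrow> real" where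
  "frame_count q x j = (\<Prod>i<j. q ^ x - q ^ i)"

lemma power_diff_ge:
  assumes "q \<ge> (2::real)" "i \<le> k"
  shows "q ^ k \<le> q ^ Suc k - q ^ i"
proof -
  have "2 * q ^ k \<le> q * q ^ k" using assms by (intro mult_right_mono) auto
  moreover have "q ^ i \<le> q ^ k" using assms by (intro power_increasing) auto
  ultimately show ?thesis by simp
qed

lemma qfact_ge_1:
  assumes "q \<ge> 2"
  shows "qfact q i \<ge> 1"
  unfolding qfact_def
proof (rule prod_ge_1)
  fix l assume "l \<in> {1..i}"
  then obtain m where "l = Suc m" by (cases l) auto
  moreover have "1 \<le> q ^ m" using assms by (intro one_le_power) auto
  ultimately show "1 \<le> q ^ l - 1" using power_diff_ge[OF assms, of 0 m] by simp
qed

lemma qfact_pos: "q \<ge> 2 \<Longrightarrow> qfact q i > 0"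
  using qfact_ge_1[of q i] by simp

lemma frame_count_eq_0: "x < j \<Longrightarrow> frame_count q x j = 0"
  by (auto simp: frame_count_def)

text \<open>
  Modulo the span of \<open>k\<close> vectors the remaining \<open>i\<close> vectors form an independent list in a space of
  dimension \<open>m\<close>, and each of them has \<open>q\<^sup>k\<close> lifts.
\<close>

lemma frame_count_add: "frame_count q (k + m) (k + i) = frame_count q (k + m) k * q ^ (k * i) * frame_count q m i"
  by (induction i) (simp_all add: frame_count_def power_add algebra_simps)

lemma frame_count_diag_ge:
  assumes "q \<ge> 2"
  shows "frame_count q k k \<ge> q ^ (k * (k - 1))"
proof -
  have "(\<Prod>i<k. q ^ (k - 1)) \<le> frame_count q k k"
    unfolding frame_count_def
  proof (rule prod_mono)
    fix i assume "i \<in> {..<k}"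
    then show "0 \<le> q ^ (k - 1) \<and> q ^ (k - 1) \<le> q ^ k - q ^ i"
      using assms power_diff_ge[of q i "k - 1"] by auto
  qed
  then show ?thesis by (simp add: mult.commute flip: power_mult)
qed

lemma frame_count_diag_pos: "q \<ge> 2 \<Longrightarrow> frame_count q k k > 0"
  using frame_count_diag_ge[of q k] by (rule less_le_trans[rotated]) simp_all

lemma frame_count_diag:
  assumes "q > 0"
  shows "frame_count q k k = q ^ (k ^ 2) * (\<Prod>i=1..k. 1 - 1 / q ^ i)"
proof -
  have "frame_count q k k = (\<Prod>i<k. q ^ k * (1 - 1 / q ^ (k - i)))"
    unfolding frame_count_def using assms
    by (intro prod.cong) (auto simp: field_simps power_diff)
  also have "\<dots> = (q ^ k) ^ k * (\<Prod>i<k. 1 - 1 / q ^ Suc (k - Suc i))"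
    by (simp add: prod.distrib Suc_diff_Suc)
  also have "(\<Prod>i<k. 1 - 1 / q ^ Suc (k - Suc i)) = (\<Prod>i<k. 1 - 1 / q ^ Suc i)"
    by (rule prod.nat_diff_reindex)
  also have "\<dots> = (\<Prod>i=1..k. 1 - 1 / q ^ i)"
    by (simp add: prod.atLeast1_atMost_eq)
  finally show ?thesis by (simp add: power_mult power2_eq_square)
qed

text \<open>
  The \<open>q\<close>-analogue of \<open>(\<Sum>i\<le>N. (-1)\<^sup>i (m choose i)) = (-1)\<^sup>N (m - 1 choose N)\<close>. The step from \<open>N\<close> to
  \<open>N + 1\<close> uses \<open>(q\<^sup>N\<^sup>+\<^sup>1 - 1) - (q\<^sup>m - 1) = -(q\<^sup>m - q\<^sup>N\<^sup>+\<^sup>1)\<close>.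
\<close>

lemma alternating_frame_sum:
  assumes "q \<ge> 2"
  shows "(\<Sum>i\<le>N. (-1) ^ i * frame_count q m i / qfact q i) = (-1) ^ N * (\<Prod>l=1..N. q ^ m - q ^ l) / qfact q N"
proof (induction N)
  case 0
  then show ?case by (simp add: frame_count_def)
next
  case (Suc N)
  let ?P = "\<Prod>l=1..N. q ^ m - q ^ l"
  have fc: "frame_count q m (Suc N) = (q ^ m - 1) * ?P"
    unfolding frame_count_def by (subst prod.lessThan_Suc_shift) (simp add: prod.atLeast1_atMost_eq)
  have nz: "qfact q N \<noteq> 0" "q ^ Suc N - 1 \<noteq> 0"
    using qfact_pos[OF assms, of N] qfact_pos[OF assms, of "Suc N"] by auto
  have "(-1) ^ N * ?P / qfact q N = (-1) ^ N * ?P * (q ^ Suc N - 1) / qfact q (Suc N)"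
    using nz by simp
  then have "(\<Sum>i\<le>Suc N. (-1) ^ i * frame_count q m i / qfact q i) =
      ((-1) ^ N * ?P * (q ^ Suc N - 1) + (-1) ^ Suc N * ((q ^ m - 1) * ?P)) / qfact q (Suc N)"
    by (simp only: sum.atMost_Suc Suc.IH fc add_divide_distrib)
  also have "(-1) ^ N * ?P * (q ^ Suc N - 1) + (-1) ^ Suc N * ((q ^ m - 1) * ?P) =
      (-1) ^ Suc N * (\<Prod>l=1..Suc N. q ^ m - q ^ l)"
    by (simp add: algebra_simps)
  finally show ?case .
qed

lemma alternating_frame_sum_eq_indicator:
  assumes "q \<ge> 2" "m \<le> N"
  shows "(\<Sum>i\<le>N. (-1) ^ i * frame_count q m i / qfact q i) = (if m = 0 then 1 else 0)"
proof (cases "m = 0")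
  case True
  have "(-1) ^ N * (\<Prod>l=1..N. q ^ 0 - q ^ l) = qfact q N"
    unfolding qfact_def by (induction N) (simp_all add: algebra_simps)
  then show ?thesis
    using True qfact_pos[OF assms(1), of N] by (simp add: alternating_frame_sum[OF assms(1)])
next
  case False
  then have "(\<Prod>l=1..N. q ^ m - q ^ l) = 0"
    using assms(2) by (intro prod_zero) auto
  then show ?thesis using False by (simp add: alternating_frame_sum[OF assms(1)])
qed

text \<open>
  Inversion of the moments. For \<open>x < k\<close> all terms vanish; for \<open>x = k + m\<close> the common factor of the
  terms can be taken out by \<open>frame_count_add\<close>, and what remains is the alternating sum for \<open>m\<close>. The
  upper limit only has to be at least \<open>x - k\<close>, so moments of order up to \<open>n\<close> suffice for all
  \<open>x \<le> n\<close>.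
\<close>

lemma indicator_eq_frame_sum:
  assumes "q \<ge> 2" "x \<le> n"
  shows "(\<Sum>i<Suc n - k. (-1) ^ i * frame_count q x (k + i) / (q ^ (k * i) * qfact q i)) =
    (if x = k then frame_count q k k else 0)"
proof (cases "k \<le> x")
  case False
  then show ?thesis by (simp add: frame_count_eq_0)
next
  case True
  then obtain m where x: "x = k + m" using le_Suc_ex by blast
  then have "{..<Suc n - k} = {..n - k}" "m \<le> n - k" using assms(2) by auto
  have "(\<Sum>i\<le>n - k. (-1) ^ i * frame_count q x (k + i) / (q ^ (k * i) * qfact q i)) =
      frame_count q x k * (\<Sum>i\<le>n - k. (-1) ^ i * frame_count q m i / qfact q i)"
    unfolding sum_distrib_left x frame_count_add using assms(1) by (intro sum.cong) auto
  then show ?thesis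
    using alternating_frame_sum_eq_indicator[OF assms(1) \<open>m \<le> n - k\<close>] x
    by (simp add: \<open>{..<Suc n - k} = {..n - k}\<close>)
qed

section \<open>Euler's series\<close>

context
  fixes q :: real
  assumes q: "q \<ge> 2"
begin

definition euler_term :: "real \<Rightarrow> nat \<Rightarrow> real" where
  "euler_term z i = z ^ i / qfact q i"

text \<open>
  Euler's expansion of \<open>(1 - z/q) (1 - z/q\<^sup>2) (1 - z/q\<^sup>3) \<dots>\<close>.
\<close>

definition euler_sum :: "real \<Rightarrow> real" where
  "euler_sum z = (\<Sum>i. (-1) ^ i * euler_term z i)"

lemma euler_term_nonneg: "0 \<le> z \<Longrightarrow> 0 \<le> euler_term z i"
  using qfact_pos[OF q, of i] by (simp add: euler_term_def)

lemma euler_term_Suc: "euler_term z (Suc i) = euler_term z i * (z / (q ^ Suc i - 1))"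
  by (simp add: euler_term_def)

lemma power_Suc_minus_one_ge: "q ^ Suc i - 1 \<ge> 2 ^ i"
  using power_diff_ge[OF q, of 0 i] power_mono[OF q, of i] by simp

lemma euler_term_Suc_le:
  assumes "0 \<le> z" "z \<le> 1"
  shows "euler_term z (Suc i) \<le> euler_term z i / 2 ^ i"
proof -
  have "z / (q ^ Suc i - 1) \<le> 1 / 2 ^ i"
    using assms power_Suc_minus_one_ge by (intro frac_le) auto
  then show ?thesis
    using mult_left_mono[OF _ euler_term_nonneg[OF assms(1)]] by (fastforce simp: euler_term_Suc)
qed

lemma summable_euler_term:
  assumes "0 \<le> z" "z \<le> 1"
  shows "summable (euler_term z)"
proof (rule summable_ratio_test[of "1/2" 1])
  fix i :: nat assume "i \<ge> 1"
  then have "(2::real) ^ 1 \<le> 2 ^ i" by (intro power_increasing) auto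
  then have "euler_term z i / 2 ^ i \<le> euler_term z i / 2"
    using euler_term_nonneg[OF assms(1), of i] by (intro divide_left_mono) auto
  then show "norm (euler_term z (Suc i)) \<le> 1 / 2 * norm (euler_term z i)"
    using euler_term_Suc_le[OF assms, of i] euler_term_nonneg[OF assms(1), of i]
      euler_term_nonneg[OF assms(1), of "Suc i"] by (simp only: real_norm_def abs_of_nonneg)
qed simp

lemma euler_term_decreasing:
  assumes "0 \<le> z" "z \<le> 1"
  shows "euler_term z (Suc i) \<le> euler_term z i"
proof -
  have "euler_term z i / 2 ^ i \<le> euler_term z i / 1"
    using euler_term_nonneg[OF assms(1), of i] by (intro divide_left_mono) auto
  then show ?thesis using euler_term_Suc_le[OF assms, of i] by simp
qed

text \<open>
  The terms decrease, so the partial sums lie alternately below and above the limit and the error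
  is at most the first omitted term.
\<close>

lemma euler_sum_error:
  assumes "0 \<le> z" "z \<le> 1"
  shows "\<bar>euler_sum z - (\<Sum>i<N. (-1) ^ i * euler_term z i)\<bar> \<le> euler_term z N"
proof -
  note L = summable_Leibniz'[OF summable_LIMSEQ_zero[OF summable_euler_term[OF assms]]
      euler_term_nonneg[OF assms(1)] euler_term_decreasing[OF assms], folded euler_sum_def]
  obtain m where "N = 2 * m \<or> N = 2 * m + 1" by (metis oddE evenE)
  then show ?thesis
    using L(2)[of m] L(4)[of m] L(2)[of "Suc m"] by auto
qed

lemma summable_alternating_euler:
  assumes "0 \<le> z" "z \<le> 1"
  shows "summable (\<lambda>i. (-1) ^ i * euler_term z i)"
  using summable_euler_term[OF assms] euler_term_nonneg[OF assms(1)]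
  by (intro summable_rabs_cancel[of "\<lambda>i. (-1) ^ i * euler_term z i"]) (simp add: abs_mult)

text \<open>
  In the difference of the two series \<open>z\<^sup>i - (z/q)\<^sup>i = (z/q)\<^sup>i (q\<^sup>i - 1)\<close> cancels the last factor of the
  denominator, so the difference is \<open>-z/q\<close> times the series at \<open>z/q\<close>, shifted by one index.
\<close>

lemma euler_sum_functional_equation:
  assumes "0 \<le> z" "z \<le> 1"
  shows "euler_sum z = (1 - z / q) * euler_sum (z / q)"
proof -
  have zq: "0 \<le> z / q" "z / q \<le> 1" using assms q by (auto simp: divide_le_eq)
  note s = summable_alternating_euler[OF assms] summable_alternating_euler[OF zq]
  let ?d = "\<lambda>i. (-1) ^ i * euler_term z i - (-1) ^ i * euler_term (z / q) i"
  have d: "?d (Suc i) = - (z / q) * ((-1) ^ i * euler_term (z / q) i)" for i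
  proof -
    have nz: "qfact q i \<noteq> 0" "q ^ Suc i - 1 \<noteq> 0"
      using qfact_pos[OF q, of i] qfact_pos[OF q, of "Suc i"] by auto
    have "euler_term z (Suc i) - euler_term (z / q) (Suc i) = (z / q) ^ Suc i * (q ^ Suc i - 1) / qfact q (Suc i)"
    proof -
      have "z ^ Suc i = (z / q) ^ Suc i * q ^ Suc i" using q by (simp add: power_divide)
      then show ?thesis by (simp add: euler_term_def right_diff_distrib diff_divide_distrib del: power_Suc)
    qed
    also have "\<dots> = (z / q) ^ Suc i / qfact q i" using nz by simp
    finally show ?thesis by (simp add: euler_term_def algebra_simps)
  qed
  have "euler_sum z - euler_sum (z / q) = (\<Sum>i. ?d i)"
    unfolding euler_sum_def by (rule suminf_diff[OF s])
  also have "\<dots> = (\<Sum>i. ?d (Suc i)) + ?d 0"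
    using suminf_split_head[OF summable_diff[OF s]] by simp
  also have "\<dots> = - (z / q) * euler_sum (z / q)"
    unfolding d euler_sum_def using suminf_mult[OF s(2), of "- (z / q)"] by (simp add: euler_term_def)
  finally show ?thesis by (simp add: algebra_simps)
qed

text \<open>
  Iterating the functional equation splits off the first \<open>m\<close> factors of the product and leaves the
  series at \<open>z/q\<^sup>m\<close>, which tends to \<open>1\<close>.
\<close>

lemma euler_product:
  assumes "0 \<le> z" "z \<le> 1"
  shows "(\<Prod>i. 1 - z / q ^ Suc i) = euler_sum z"
proof -
  have zq: "0 \<le> z / q ^ m \<and> z / q ^ m \<le> 1" for m
  proof -
    have "1 \<le> q ^ m" using q by (intro one_le_power) auto
    then show ?thesis using assms by (auto simp: divide_le_eq)
  qed
  have partial: "(\<Prod>i<m. 1 - z / q ^ Suc i) * euler_sum (z / q ^ m) = euler_sum z" for m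
  proof (induction m)
    case (Suc m)
    then show ?case
      using euler_sum_functional_equation[of "z / q ^ m"] zq by (simp add: mult_ac)
  qed simp
  have "(\<lambda>m. z * (1 / q) ^ m) \<longlonglongrightarrow> z * 0"
    using q by (intro tendsto_mult tendsto_const LIMSEQ_realpow_zero) auto
  then have z0: "(\<lambda>m. z / q ^ m) \<longlonglongrightarrow> 0" by (simp add: power_one_over)
  have near1: "\<bar>euler_sum (z / q ^ m) - 1\<bar> \<le> z / q ^ m" for m
    using euler_sum_error[of "z / q ^ m" 1] euler_term_Suc_le[of "z / q ^ m" 0] zq[of m]
      frac_le[of "z / q ^ m" "z / q ^ m" 1 "q - 1"] q by (simp add: euler_term_def)
  have "(\<lambda>m. euler_sum (z / q ^ m) - 1) \<longlonglongrightarrow> 0"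
    by (rule Lim_null_comparison[OF always_eventually z0]) (simp add: near1)
  then have lim1: "(\<lambda>m. euler_sum (z / q ^ m)) \<longlonglongrightarrow> 1"
    by (rule LIM_zero_cancel)
  have "summable (\<lambda>k. \<bar>- (z / q ^ Suc k)\<bar>)"
  proof -
    have "summable (\<lambda>k. (z / q) * (1 / q) ^ k)"
      using q by (intro summable_mult summable_geometric) auto
    then show ?thesis using assms q by (simp add: abs_mult power_one_over)
  qed
  moreover have "- (z / q ^ Suc k) \<noteq> -1" for k
  proof -
    have "q ^ Suc k > 1" using q by (intro one_less_power) auto
    then show ?thesis using assms q by (simp add: divide_eq_1_iff)
  qed
  ultimately have "convergent_prod (\<lambda>i. 1 + - (z / q ^ Suc i))"
    by (rule summable_imp_convergent_prod_real)
  then have "(\<lambda>m. \<Prod>i\<le>m. 1 - z / q ^ Suc i) \<longlonglongrightarrow> (\<Prod>i. 1 - z / q ^ Suc i)"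
    using convergent_prod_LIMSEQ by fastforce
  then have "(\<lambda>m. \<Prod>i<m. 1 - z / q ^ Suc i) \<longlonglongrightarrow> (\<Prod>i. 1 - z / q ^ Suc i)"
    by (simp add: LIMSEQ_lessThan_iff_atMost)
  from tendsto_mult[OF this lim1]
  have "(\<lambda>m::nat. euler_sum z) \<longlonglongrightarrow> (\<Prod>i. 1 - z / q ^ Suc i)"
    unfolding partial by simp
  then show ?thesis by (simp add: LIMSEQ_const_iff)
qed

section \<open>Point masses and truncation\<close>

text \<open>
  With \<open>N = n + 1 - k\<close> terms this is the probability that \<open>A - I\<close> has corank \<open>k\<close>; with the full series
  it is the point mass of the limit.
\<close>

definition truncated_mass :: "nat \<Rightarrow> nat \<Rightarrow> real" where
  "truncated_mass N k = (\<Sum>i<N. (-1) ^ i * euler_term (1 / q ^ k) i) / frame_count q k k"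

text \<open>
  The subtraction \<open>Suc n - k\<close> is truncated at \<open>0\<close>, so that the case \<open>k > n\<close>, where nothing has been
  summed, is included. For \<open>k \<ge> 1\<close> the powers of \<open>q\<close> in the denominator have total exponent at least
  \<open>k (k - 1) + k (n + 1 - k) = k n \<ge> n + (k - 1)\<close> when \<open>k \<le> n\<close>, and \<open>k (k - 1) \<ge> k n\<close> otherwise. For
  \<open>k = 0\<close> they contribute nothing, and the last factor \<open>q\<^sup>n\<^sup>+\<^sup>1 - 1\<close> of the \<open>q\<close>-factorial provides the
  bound.
\<close>

lemma truncation_error_bound:
  assumes "n \<ge> 1"
  shows "euler_term (1 / q ^ k) (Suc n - k) / frame_count q k k \<le> 2 * (1 / 2) ^ k / q ^ n"
proof (cases k)
  case 0
  have "q ^ n \<le> qfact q (Suc n)"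
  proof -
    have "1 * q ^ n \<le> qfact q n * (q ^ Suc n - 1)"
      using power_diff_ge[OF q, of 0 n] qfact_ge_1[OF q, of n] q by (intro mult_mono) auto
    then show ?thesis by simp
  qed
  then have "1 / qfact q (Suc n) \<le> 1 / q ^ n" using q by (intro frac_le) auto
  also have "\<dots> \<le> 2 / q ^ n" using q by (intro divide_right_mono) auto
  finally show ?thesis using 0 by (simp add: euler_term_def frame_count_def)
next
  case (Suc k')
  let ?i = "Suc n - k"
  have "k * n \<le> k * (k - 1) + k * ?i" by (cases "k \<le> Suc n") (auto simp flip: add_mult_distrib2)
  moreover have "n + k' \<le> k * n" using Suc assms by (cases n) auto
  ultimately have e: "n + k' \<le> k * (k - 1) + k * ?i" by simp
  have "2 ^ k' * q ^ n \<le> q ^ k' * q ^ n" using q by (intro mult_right_mono power_mono) auto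
  also have "\<dots> = q ^ (n + k')" by (simp add: power_add)
  also have "\<dots> \<le> q ^ (k * (k - 1) + k * ?i)" using q e by (intro power_increasing) auto
  also have "\<dots> = q ^ (k * ?i) * 1 * q ^ (k * (k - 1))" by (simp add: power_add)
  also have "\<dots> \<le> q ^ (k * ?i) * qfact q ?i * frame_count q k k"
    using q qfact_ge_1[OF q, of ?i] frame_count_diag_ge[OF q, of k] by (intro mult_mono) auto
  finally have "1 / (q ^ (k * ?i) * qfact q ?i * frame_count q k k) \<le> 1 / (2 ^ k' * q ^ n)"
    using q by (intro frac_le) auto
  moreover have "euler_term (1 / q ^ k) ?i / frame_count q k k =
      1 / (q ^ (k * ?i) * qfact q ?i * frame_count q k k)"
    by (simp add: euler_term_def power_one_over power_mult del: power_Suc)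
  moreover have "2 * (1 / 2) ^ k / q ^ n = 1 / (2 ^ k' * q ^ n)"
    by (simp add: Suc power_one_over)
  ultimately show ?thesis by (simp only:)
qed

end

lemma Q_inf_mass_eq:
  assumes "q \<ge> 2"
  shows "Q_inf_mass q k = euler_sum (real q) (1 / real q ^ k) / frame_count (real q) k k"
proof -
  have q: "real q \<ge> 2" using assms by simp
  have "1 / real q ^ k \<le> 1" using q one_le_power[of "real q" k] by (simp add: divide_le_eq)
  then have "(\<Prod>i. 1 - 1 / real q ^ k / real q ^ Suc i) = euler_sum (real q) (1 / real q ^ k)"
    using q by (intro euler_product) auto
  moreover have "1 / real q ^ k / real q ^ Suc i = 1 / real q ^ (k + 1 + i)" for i
    by (simp add: power_add)
  ultimately have "(\<Prod>i. 1 - 1 / real q ^ (k + 1 + i)) = euler_sum (real q) (1 / real q ^ k)"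
    by (simp only:)
  moreover have "frame_count (real q) k k = real q ^ (k ^ 2) * (\<Prod>i=1..k. 1 - 1 / real q ^ i)"
    using q by (intro frame_count_diag) simp
  ultimately show ?thesis
    unfolding Q_inf_mass_def by (simp only: times_divide_times_eq mult_1)
qed

lemma Q_inf_mass_truncation:
  assumes "q \<ge> 2" "n \<ge> 1"
  shows "\<bar>truncated_mass (real q) (Suc n - k) k - Q_inf_mass q k\<bar> \<le> 2 * (1 / 2) ^ k / real q ^ n"
proof -
  have q: "real q \<ge> 2" using assms by simp
  have z: "1 / real q ^ k \<le> 1" using q one_le_power[of "real q" k] by (simp add: divide_le_eq)
  have "\<bar>truncated_mass (real q) (Suc n - k) k - Q_inf_mass q k\<bar> =
      \<bar>euler_sum (real q) (1 / real q ^ k) - (\<Sum>i<Suc n - k. (-1) ^ i * euler_term (real q) (1 / real q ^ k) i)\<bar>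
        / frame_count (real q) k k"
    using frame_count_diag_pos[OF q, of k]
    by (simp add: Q_inf_mass_eq[OF assms(1)] truncated_mass_def[OF q] abs_minus_commute
        flip: diff_divide_distrib)
  also have "\<dots> \<le> euler_term (real q) (1 / real q ^ k) (Suc n - k) / frame_count (real q) k k"
    using frame_count_diag_pos[OF q, of k] z q
    by (intro divide_right_mono euler_sum_error) auto
  also have "\<dots> \<le> 2 * (1 / 2) ^ k / real q ^ n"
    by (rule truncation_error_bound[OF q assms(2)])
  finally show ?thesis .
qed

text \<open>
  The series is at least the difference of its first two terms, which are \<open>1\<close> and at most \<open>1\<close>.
\<close>

lemma Q_inf_mass_nonneg:
  assumes "q \<ge> 2"
  shows "Q_inf_mass q k \<ge> 0"
proof -
  have q: "real q \<ge> 2" using assms by simp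
  have z: "1 / real q ^ k \<le> 1" using q one_le_power[of "real q" k] by (simp add: divide_le_eq)
  have "euler_term (real q) (1 / real q ^ k) 1 \<le> 1"
    using euler_term_decreasing[OF q _ z, of 0] by (simp add: euler_term_def[OF q])
  then have "0 \<le> euler_sum (real q) (1 / real q ^ k)"
    using euler_sum_error[OF q _ z, of 1] by (simp add: euler_term_def[OF q])
  then show ?thesis using frame_count_diag_pos[OF q, of k] by (simp add: Q_inf_mass_eq[OF assms])
qed

section \<open>Total variation distance\<close>

lemma measure_density_nat:
  fixes m :: "nat \<Rightarrow> real"
  assumes "\<And>k. 0 \<le> m k" "summable m"
  shows "measure (density (count_space UNIV) (\<lambda>k. ennreal (m k))) A = (\<Sum>k. m k * indicator A k)"
proof -
  have s: "summable (\<lambda>k. m k * indicator A k)"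
    by (rule summable_comparison_test'[OF assms(2), of 0]) (use assms(1) in \<open>auto simp: indicator_def\<close>)
  have "emeasure (density (count_space UNIV) (\<lambda>k. ennreal (m k))) A =
      (\<Sum>k. ennreal (m k) * indicator A k)"
    by (simp add: emeasure_density nn_integral_count_space_nat)
  also have "\<dots> = (\<Sum>k. ennreal (m k * indicator A k))"
    by (intro arg_cong[of _ _ suminf] ext) (simp add: indicator_def)
  also have "\<dots> = ennreal (\<Sum>k. m k * indicator A k)"
    using assms(1) s by (intro suminf_ennreal2) auto
  finally show ?thesis
    using assms(1) s by (intro measure_eq_emeasure_eq_ennreal suminf_nonneg) auto
qed

lemma summable_pmf_nat: "summable (pmf (p :: nat pmf))"
  using pmf_abs_summable[of p UNIV] by (simp add: abs_summable_on_nat_iff')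

text \<open>
  The distance is at most the sum of the differences of the point masses. That \<open>m\<close> is summable, so
  that its density is a finite measure, follows from the bounds \<open>e\<close>.
\<close>

lemma tv_dist_density_le:
  fixes p :: "nat pmf" and m e :: "nat \<Rightarrow> real"
  assumes m: "\<And>k. 0 \<le> m k" and e: "summable e" and le: "\<And>k. \<bar>pmf p k - m k\<bar> \<le> e k"
  shows "tv_dist (measure_pmf p) (density (count_space UNIV) (\<lambda>k. ennreal (m k))) \<le> suminf e"
  unfolding tv_dist_def
proof (rule cSUP_least)
  have "m k \<le> pmf p k + e k" for k using le[of k] by linarith
  then have sm: "summable m"
    using m by (intro summable_comparison_test'[OF summable_add[OF summable_pmf_nat e], of 0]) auto
  fix A
  have ind: "summable (\<lambda>k. f k * indicator A k)" if "summable f" "\<And>k. 0 \<le> f k" for f :: "nat \<Rightarrow> real"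
    by (rule summable_comparison_test'[OF that(1), of 0]) (use that(2) in \<open>auto simp: indicator_def\<close>)
  note s = ind[OF summable_pmf_nat pmf_nonneg] ind[OF sm m]
  have "\<bar>pmf p k * indicator A k - m k * indicator A k\<bar> \<le> e k" for k
    using le[of k] by (auto simp: indicator_def)
  then have "\<bar>\<Sum>k. pmf p k * indicator A k - m k * indicator A k\<bar> \<le> suminf e"
    using summable_norm_comparison_test[of "\<lambda>k. pmf p k * indicator A k - m k * indicator A k" e] e
    by (intro order_trans[OF summable_rabs suminf_le]) (auto intro: summable_comparison_test')
  moreover have "measure (measure_pmf p) A = (\<Sum>k. pmf p k * indicator A k)"
    unfolding measure_pmf_eq_density by (intro measure_density_nat summable_pmf_nat) simp
  ultimately show "\<bar>measure (measure_pmf p) A - measure (density (count_space UNIV) (\<lambda>k. ennreal (m k))) A\<bar> \<le> suminf e"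
    using suminf_diff[OF s] by (simp add: measure_density_nat[OF m sm])
qed simp

context finite_matrices
begin

abbreviation "corank_minus_one A \<equiv> corank F n (A \<ominus>\<^bsub>M\<^esub> \<one>\<^bsub>M\<^esub>)"

text \<open>
  Summation over \<open>GL\<close> of the inversion formula for the indicator; each moment that occurs has order
  at most \<open>n\<close> and contributes \<open>|GL|\<close>.
\<close>

lemma card_GL_corank_eq:
  "real (card {A \<in> GL n F. corank_minus_one A = k}) =
    real (card (GL n F)) * truncated_mass (real q) (Suc n - k) k"
proof -
  have q: "real q \<ge> 2" using card_field_gt_1 by simp
  let ?c = "\<lambda>i. (-1) ^ i / (real q ^ (k * i) * qfact (real q) i)"
  have "real (card {A \<in> GL n F. corank_minus_one A = k}) * frame_count (real q) k k =
      (\<Sum>A\<in>GL n F. if corank_minus_one A = k then frame_count (real q) k k else 0)"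
    using finite_GL[OF finite_F] by (simp add: sum.If_cases Collect_conj_eq)
  also have "\<dots> = (\<Sum>A\<in>GL n F. \<Sum>i<Suc n - k. ?c i * frame_count (real q) (corank_minus_one A) (k + i))"
  proof (rule sum.cong[OF refl])
    fix A assume "A \<in> GL n F"
    then have "corank_minus_one A \<le> n" by (intro card_ker_mat_vec(2)) auto
    from indicator_eq_frame_sum[OF q this, of k]
    show "(if corank_minus_one A = k then frame_count (real q) k k else 0) =
        (\<Sum>i<Suc n - k. ?c i * frame_count (real q) (corank_minus_one A) (k + i))"
      by (simp only: times_divide_eq_left)
  qed
  also have "\<dots> = (\<Sum>i<Suc n - k. ?c i * (\<Sum>A\<in>GL n F. frame_count (real q) (corank_minus_one A) (k + i)))"
    by (subst sum.swap) (simp add: sum_distrib_left)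
  also have "\<dots> = (\<Sum>i<Suc n - k. ?c i * real (card (GL n F)))"
    by (intro sum.cong refl arg_cong2[of _ _ _ _ times])
      (auto simp: frame_count_def intro!: sum_GL_corank_moment)
  also have "\<dots> = real (card (GL n F)) * (\<Sum>i<Suc n - k. (-1) ^ i * euler_term (real q) (1 / real q ^ k) i)"
    unfolding sum_distrib_left euler_term_def[OF q]
    by (intro sum.cong refl) (simp add: power_one_over power_mult)
  finally show ?thesis
    using frame_count_diag_pos[OF q, of k] by (simp add: truncated_mass_def[OF q] field_simps)
qed

definition corank_pmf :: "nat pmf" where
  "corank_pmf = map_pmf corank_minus_one (pmf_of_set (GL n F))"

lemma pmf_corank_pmf: "pmf corank_pmf k = truncated_mass (real q) (Suc n - k) k"
proof -
  have GL: "GL n F \<noteq> {}" "finite (GL n F)"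
    using GL_nonempty[OF is_ring] finite_GL[OF finite_F] by auto
  have "pmf corank_pmf k = real (card (GL n F \<inter> corank_minus_one -` {k})) / real (card (GL n F))"
    unfolding corank_pmf_def pmf_map by (rule measure_pmf_of_set[OF GL])
  also have "GL n F \<inter> corank_minus_one -` {k} = {A \<in> GL n F. corank_minus_one A = k}" by auto
  also have "real (card \<dots>) / real (card (GL n F)) = truncated_mass (real q) (Suc n - k) k"
    unfolding card_GL_corank_eq using GL by simp
  finally show ?thesis .
qed

lemma tv_dist_corank_pmf: "tv_dist (measure_pmf corank_pmf) (Q_inf q) \<le> 4 / real q ^ n"
proof -
  have q: "q \<ge> 2" using card_field_gt_1 by simp
  let ?e = "\<lambda>k. 2 / real q ^ n * (1 / 2) ^ k"
  have "?e sums (2 / real q ^ n * (1 / (1 - 1 / 2)))"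
    by (intro sums_mult geometric_sums) simp
  moreover have "\<bar>pmf corank_pmf k - Q_inf_mass q k\<bar> \<le> ?e k" for k
    using Q_inf_mass_truncation[OF q n_pos, of k] by (simp add: pmf_corank_pmf)
  ultimately show ?thesis
    using tv_dist_density_le[of "Q_inf_mass q" ?e corank_pmf] Q_inf_mass_nonneg[OF q]
    by (simp add: Q_inf_def sums_iff)
qed

end

theorem theorem1p15:
  shows "\<exists>C c :: real. C > 0 \<and> c > 0 \<and>
    (\<forall>q :: nat. primepow q \<longrightarrow>
      (\<forall>F :: nat ring. field F \<and> card (carrier F) = q \<longrightarrow>
        (\<forall>n :: nat. n \<ge> 1 \<longrightarrow>
          tv_dist
            (measure_pmf
              (map_pmf (\<lambda>A. corank F n (A \<ominus>\<^bsub>mat_ring F n\<^esub> \<one>\<^bsub>mat_ring F n\<^esub>))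
                (pmf_of_set (GL n F))))
            (Q_inf q)
          \<le> (C / real q) powr (c * real n))))"
proof (rule exI[of _ 4], rule exI[of _ 1], intro conjI allI impI; (elim conjE)?)
  fix q n :: nat and F :: "nat ring"
  assume pp: "primepow q" and "field F" and q: "card (carrier F) = q" and n: "1 \<le> n"
  have q0: "q > 0" using primepow_gt_0_nat[OF pp] .
  then have "finite (carrier F)" using q card_gt_0_iff by metis
  with \<open>field F\<close> n interpret finite_matrices F n
    by (intro finite_matrices.intro finite_matrices_axioms.intro)
  \<comment> \<open>The constant 4 is the sum of 2 * (1/2)^k over k; as n is at least 1, it is at most 4^n.\<close>
  have "tv_dist (measure_pmf corank_pmf) (Q_inf q) \<le> 4 / real q ^ n"
    using tv_dist_corank_pmf q by simp
  also have "\<dots> \<le> 4 ^ n / real q ^ n"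
    using n power_increasing[of 1 n "4::real"] by (intro divide_right_mono) auto
  also have "\<dots> = (4 / real q) powr (1 * real n)"
    using q0 by (simp add: powr_realpow power_divide)
  finally show "tv_dist (measure_pmf (map_pmf (\<lambda>A. corank F n (A \<ominus>\<^bsub>mat_ring F n\<^esub> \<one>\<^bsub>mat_ring F n\<^esub>)) (pmf_of_set (GL n F)))) (Q_inf q)
      \<le> (4 / real q) powr (1 * real n)"
    by (simp only: corank_pmf_def)
qed simp_all

end
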